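(* Let $T:c_{0}\times c_{0}\to\mathbb{R}$ be given by $T(x,y)=\sum_{i,j=1}^{2}a_{ij}x_{i}y_{j}$ with $a_{ij}\in\mathbb{R}$. Then $$\|T\|=\max\{|a_{11}+a_{21}|+|a_{12}+a_{22}|,\ |a_{11}-a_{21}|+|a_{12}-a_{22}|\}.$$
   Context: Here $c_0$ is the real Banach space of real sequences $x=(x_n)_{n\ge1}$ converging to $0$ with the sup norm, and $\|T\|=\sup\{|T(x,y)|:\|x\|_\infty\le 1,\|y\|_\infty\le 1\}$. *)

theory Defs
  imports "HOL-Analysis.Analysis"
begin

text \<open>
  The space \<open>c\<^sub>0\<close>, as the subspace of null sequences of the Banach space
  \<open>nat \<Rightarrow>\<^sub>C real\<close> of bounded real sequences with the sup norm (on the discrete space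
  \<open>nat\<close> continuity is no restriction).  Sequences are indexed from \<open>0\<close>: the
  coordinate \<open>x\<^sub>n\<close> with \<open>n \<ge> 1\<close> is \<open>c0_nth x (n - 1)\<close>.
\<close>

typedef c0 = "{x :: nat \<Rightarrow>\<^sub>C real. apply_bcontfun x \<longlonglongrightarrow> 0}"
  morphisms bcontfun_of_c0 Abs_c0
  by (intro exI[of _ 0]) simp

setup_lifting type_definition_c0

lift_definition c0_nth :: "c0 \<Rightarrow> nat \<Rightarrow> real"
  is "\<lambda>x n. apply_bcontfun x n" .

lemma range_c0_nth: "range c0_nth = {x. x \<longlonglongrightarrow> 0}"
proof (intro equalityI subsetI)
  fix x :: "nat \<Rightarrow> real" assume "x \<in> {x. x \<longlonglongrightarrow> 0}"
  then have lim: "x \<longlonglongrightarrow> 0" by simp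
  then have "x \<in> bcontfun"
    by (auto simp: bcontfun_def convergent_imp_bounded)
  then obtain y where "x = apply_bcontfun y" by (rule bcontfunE)
  with lim have "x = c0_nth (Abs_c0 y)" by (simp add: c0_nth.rep_eq Abs_c0_inverse)
  then show "x \<in> range c0_nth" by blast
qed (use bcontfun_of_c0 in \<open>auto simp: c0_nth.rep_eq\<close>)

lemma c0_eqI: "(\<And>n. c0_nth x n = c0_nth y n) \<Longrightarrow> x = y"
  by transfer (rule bcontfun_eqI)

instantiation c0 :: real_vector
begin

lift_definition zero_c0 :: c0 is 0 by simp
lift_definition plus_c0 :: "c0 \<Rightarrow> c0 \<Rightarrow> c0" is "(+)"
  by (simp add: tendsto_add_zero)
lift_definition minus_c0 :: "c0 \<Rightarrow> c0 \<Rightarrow> c0" is "(-)"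
  using tendsto_diff[of _ 0 _ _ 0] by simp
lift_definition uminus_c0 :: "c0 \<Rightarrow> c0" is uminus
  using tendsto_minus[of _ 0] by simp
lift_definition scaleR_c0 :: "real \<Rightarrow> c0 \<Rightarrow> c0" is scaleR
  by (simp add: tendsto_mult_right_zero)

instance
  by standard (transfer; simp add: algebra_simps)+

end

instantiation c0 :: real_normed_vector
begin

lift_definition norm_c0 :: "c0 \<Rightarrow> real" is norm .
lift_definition dist_c0 :: "c0 \<Rightarrow> c0 \<Rightarrow> real" is dist .
lift_definition sgn_c0 :: "c0 \<Rightarrow> c0" is sgn
  by (simp add: sgn_div_norm tendsto_mult_right_zero)

definition uniformity_c0 :: "(c0 \<times> c0) filter"
  where "uniformity_c0 = (INF e\<in>{0 <..}. principal {(x, y). dist x y < e})"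
definition open_c0 :: "c0 set \<Rightarrow> bool"
  where "open_c0 S = (\<forall>x\<in>S. \<forall>\<^sub>F (x', y) in uniformity. x' = x \<longrightarrow> y \<in> S)"

instance
proof
  fix x y :: c0 and r :: real and S :: "c0 set"
  show "dist x y = norm (x - y)" by transfer (simp add: dist_norm)
  show "sgn x = inverse (norm x) *\<^sub>R x" by transfer (simp add: sgn_div_norm)
  show "norm x = 0 \<longleftrightarrow> x = 0" by transfer simp
  show "norm (x + y) \<le> norm x + norm y" by transfer (rule norm_triangle_ineq)
  show "norm (r *\<^sub>R x) = \<bar>r\<bar> * norm x" by transfer simp
qed (simp_all add: uniformity_c0_def open_c0_def)

end

lemma norm_c0_eq_SUP: "norm (x :: c0) = (SUP n. \<bar>c0_nth x n\<bar>)"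
  by (simp add: norm_c0.rep_eq c0_nth.rep_eq norm_bcontfun_def dist_bcontfun.rep_eq)

instance c0 :: banach
proof
  fix X :: "nat \<Rightarrow> c0"
  assume "Cauchy X"
  then have "Cauchy (\<lambda>n. bcontfun_of_c0 (X n))"
    by (simp only: Cauchy_def dist_c0.rep_eq)
  then obtain g where
    "uniform_limit UNIV (\<lambda>n. apply_bcontfun (bcontfun_of_c0 (X n))) g sequentially"
    using uniformly_convergent_eq_cauchy[of "\<lambda>_. True" "\<lambda>n. apply_bcontfun (bcontfun_of_c0 (X n))"]
    unfolding Cauchy_def uniform_limit_sequentially_iff
    by (metis dist_fun_lt_imp_dist_val_lt)
  then obtain L where L: "(\<lambda>n. bcontfun_of_c0 (X n)) \<longlonglongrightarrow> L"
    using uniform_limit_bcontfunE[OF _ sequentially_bot] by metis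
  have "apply_bcontfun L \<longlonglongrightarrow> 0"
  proof (rule swap_uniform_limit')
    show "\<forall>\<^sub>F n in sequentially. (apply_bcontfun (bcontfun_of_c0 (X n)) \<longlongrightarrow> 0) sequentially"
      using bcontfun_of_c0 by auto
    show "(\<lambda>n. 0 :: real) \<longlonglongrightarrow> 0" by simp
    show "uniform_limit UNIV (\<lambda>n. apply_bcontfun (bcontfun_of_c0 (X n))) L sequentially"
      using L by (rule tendsto_bcontfun_uniform_limit)
  qed auto
  then have "X \<longlonglongrightarrow> Abs_c0 L"
    using tendsto_dist_iff[THEN iffD1, OF L] by (subst tendsto_dist_iff) (simp add: dist_c0.rep_eq Abs_c0_inverse)
  then show "convergent X" by (auto simp: convergent_def)
qed

definition bilinear_norm ::
    "('a::real_normed_vector \<Rightarrow> 'b::real_normed_vector \<Rightarrow> real) \<Rightarrow> real"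
  where "bilinear_norm T = Sup {\<bar>T x y\<bar> | x y. norm x \<le> 1 \<and> norm y \<le> 1}"

text \<open>The supremum above is taken in \<open>real\<close>; for bounded bilinear forms it is genuine.\<close>

lemma bdd_above_bilinear_norm:
  assumes "bounded_bilinear T"
  shows "bdd_above {\<bar>T x y :: real\<bar> | x y. norm x \<le> 1 \<and> norm y \<le> 1}"
proof -
  obtain K where K: "K \<ge> 0" "\<And>x y. norm (T x y) \<le> norm x * norm y * K"
    using bounded_bilinear.nonneg_bounded[OF assms] by blast
  have "\<bar>T x y\<bar> \<le> K" if "norm x \<le> 1" "norm y \<le> 1" for x y
  proof -
    have "norm x * norm y * K \<le> 1 * 1 * K"
      using that K(1) by (intro mult_mono) auto
    then show ?thesis using K(2)[of x y] by simp
  qed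
  then show ?thesis by (auto simp: bdd_above_def)
qed

end

theory Submission
  imports Defs
begin

text \<open>
  Writing \<open>u = (x\<^sub>1 + x\<^sub>2) / 2\<close> and \<open>v = (x\<^sub>1 - x\<^sub>2) / 2\<close>, the constraint
  \<open>\<bar>x\<^sub>1\<bar>, \<bar>x\<^sub>2\<bar> \<le> 1\<close> becomes \<open>\<bar>u\<bar> + \<bar>v\<bar> \<le> 1\<close>, and the coefficient of \<open>y\<^sub>j\<close> in
  \<open>T x y\<close> becomes \<open>(a\<^sub>1\<^sub>j + a\<^sub>2\<^sub>j) u + (a\<^sub>1\<^sub>j - a\<^sub>2\<^sub>j) v\<close>.  Hence \<open>\<bar>T x y\<bar>\<close> is at most a subconvex
  combination of the two quantities under the maximum.  Both are attained, at
  \<open>x = (1, \<plusminus>1, 0, \<dots>)\<close> with signs chosen for \<open>y\<close>.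
\<close>

lemma norm_c0_le_iff: "norm (x :: c0) \<le> b \<longleftrightarrow> (\<forall>n. \<bar>c0_nth x n\<bar> \<le> b)"
proof
  assume "norm x \<le> b"
  then show "\<forall>n. \<bar>c0_nth x n\<bar> \<le> b"
    by transfer (metis norm_bounded order_trans real_norm_def)
next
  assume "\<forall>n. \<bar>c0_nth x n\<bar> \<le> b"
  then show "norm x \<le> b" unfolding norm_c0_eq_SUP by (auto intro: cSUP_least)
qed

text \<open>Padding with zeros keeps the limit 0 and adds nothing to the sup norm, so the first two
  coordinates of the unit ball of \<open>c0\<close> fill the whole square. This supplies the
  extremal vectors.\<close>

lemma exists_c0_first_two:
  assumes "\<bar>s\<bar> \<le> 1" "\<bar>t\<bar> \<le> 1"
  obtains x :: c0 where "norm x \<le> 1" "c0_nth x 0 = s" "c0_nth x 1 = t"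
proof -
  define f where "f = (\<lambda>n::nat. if n = 0 then s else if n = 1 then t else 0)"
  have "\<forall>\<^sub>F n in sequentially. f n = 0"
    using eventually_ge_at_top[of 2] by eventually_elim (auto simp: f_def)
  then have "f \<in> range c0_nth"
    unfolding range_c0_nth by (simp add: tendsto_eventually)
  then obtain x where x: "f = c0_nth x" by blast
  have "norm x \<le> 1"
    using assms by (auto simp: norm_c0_le_iff x[symmetric] f_def)
  then show thesis using that[of x] by (simp add: x[symmetric] f_def)
qed

lemma bilinear_form_2x2_le:
  fixes a b c d x x' y y' :: real
  assumes "\<bar>x\<bar> \<le> 1" "\<bar>x'\<bar> \<le> 1" "\<bar>y\<bar> \<le> 1" "\<bar>y'\<bar> \<le> 1"
  shows "\<bar>a * x * y + b * x * y' + (c * x' * y + d * x' * y')\<bar>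
    \<le> max (\<bar>a + c\<bar> + \<bar>b + d\<bar>) (\<bar>a - c\<bar> + \<bar>b - d\<bar>)" (is "_ \<le> max ?M ?N")
proof -
  define u v where "u = (x + x') / 2" and "v = (x - x') / 2"
  \<comment> \<open>In fact |u| + |v| is the larger of |x| and |x'|.\<close>
  have uv: "\<bar>u\<bar> + \<bar>v\<bar> \<le> 1" using assms(1,2) by (auto simp: u_def v_def abs_if field_simps)
  have "a * x * y + b * x * y' + (c * x' * y + d * x' * y')
      = ((a + c) * u + (a - c) * v) * y + ((b + d) * u + (b - d) * v) * y'"
    by (simp add: u_def v_def field_simps)
  also have "\<bar>\<dots>\<bar> \<le> \<bar>(a + c) * u + (a - c) * v\<bar> * \<bar>y\<bar> + \<bar>(b + d) * u + (b - d) * v\<bar> * \<bar>y'\<bar>"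
    by (simp add: abs_mult[symmetric] abs_triangle_ineq)
  also have "\<dots> \<le> \<bar>(a + c) * u + (a - c) * v\<bar> + \<bar>(b + d) * u + (b - d) * v\<bar>"
    using assms(3,4) by (intro add_mono mult_left_le) auto
  also have "\<dots> \<le> (\<bar>a + c\<bar> * \<bar>u\<bar> + \<bar>a - c\<bar> * \<bar>v\<bar>) + (\<bar>b + d\<bar> * \<bar>u\<bar> + \<bar>b - d\<bar> * \<bar>v\<bar>)"
    by (intro add_mono) (simp_all add: abs_mult[symmetric] abs_triangle_ineq)
  \<comment> \<open>Collecting by the weights |u| and |v| produces the two candidate values.\<close>
  also have "\<dots> = ?M * \<bar>u\<bar> + ?N * \<bar>v\<bar>" by (simp add: algebra_simps)
  also have "\<dots> \<le> max ?M ?N * \<bar>u\<bar> + max ?M ?N * \<bar>v\<bar>"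
    by (intro add_mono mult_right_mono) auto
  also have "\<dots> = max ?M ?N * (\<bar>u\<bar> + \<bar>v\<bar>)" by (simp add: algebra_simps)
  also have "\<dots> \<le> max ?M ?N" using uv by (intro mult_left_le) auto
  finally show ?thesis .
qed

theorem proposition2p2:
  fixes a :: "nat \<Rightarrow> nat \<Rightarrow> real" and T :: "c0 \<Rightarrow> c0 \<Rightarrow> real"
  assumes "\<And>x y. T x y = (\<Sum>i<2. \<Sum>j<2. a i j * c0_nth x i * c0_nth y j)"
  shows "bilinear_norm T =
    max (\<bar>a 0 0 + a 1 0\<bar> + \<bar>a 0 1 + a 1 1\<bar>) (\<bar>a 0 0 - a 1 0\<bar> + \<bar>a 0 1 - a 1 1\<bar>)"
proof -
  let ?S = "{\<bar>T x y\<bar> | x y. norm x \<le> 1 \<and> norm y \<le> 1}"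
  have T: "T x y = a 0 0 * c0_nth x 0 * c0_nth y 0 + a 0 1 * c0_nth x 0 * c0_nth y 1
      + (a 1 0 * c0_nth x 1 * c0_nth y 0 + a 1 1 * c0_nth x 1 * c0_nth y 1)" for x y
    by (simp add: assms numeral_2_eq_2)
  \<comment> \<open>The sign \<open>e\<close> handles both extremal vectors at once: 1 gives the
    first term of the maximum, -1 the second.\<close>
  have attained: "\<bar>a 0 0 + e * a 1 0\<bar> + \<bar>a 0 1 + e * a 1 1\<bar> \<in> ?S" if e: "\<bar>e\<bar> = 1" for e
  proof -
    obtain x :: c0 where x: "norm x \<le> 1" "c0_nth x 0 = 1" "c0_nth x 1 = e"
      by (rule exists_c0_first_two[of 1 e]) (use e in auto)
    let ?p = "a 0 0 + e * a 1 0" and ?q = "a 0 1 + e * a 1 1"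
    \<comment> \<open>With \<open>x\<close> fixed, the form in \<open>y\<close> has coefficients
      \<open>?p\<close> and \<open>?q\<close>, so matching signs make both terms absolute values.
      The case \<open>sgn 0 = 0\<close> is harmless, as that term vanishes anyway.\<close>
    obtain y :: c0 where y: "norm y \<le> 1" "c0_nth y 0 = sgn ?p" "c0_nth y 1 = sgn ?q"
      by (rule exists_c0_first_two[of "sgn ?p" "sgn ?q"]) (auto simp: abs_sgn_eq)
    have "T x y = ?p * sgn ?p + ?q * sgn ?q"
      unfolding T x y by (simp add: algebra_simps)
    also have "\<dots> = \<bar>?p\<bar> + \<bar>?q\<bar>" by (simp only: abs_sgn)
    finally have "\<bar>?p\<bar> + \<bar>?q\<bar> = \<bar>T x y\<bar>" by simp
    with x(1) y(1) show ?thesis by blast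
  qed
  have "Sup ?S = max (\<bar>a 0 0 + a 1 0\<bar> + \<bar>a 0 1 + a 1 1\<bar>) (\<bar>a 0 0 - a 1 0\<bar> + \<bar>a 0 1 - a 1 1\<bar>)"
  proof (rule cSup_eq_maximum)
    show "max (\<bar>a 0 0 + a 1 0\<bar> + \<bar>a 0 1 + a 1 1\<bar>) (\<bar>a 0 0 - a 1 0\<bar> + \<bar>a 0 1 - a 1 1\<bar>) \<in> ?S"
      using attained[of 1] attained[of "-1"] by (simp add: max_def)
  next
    fix z assume "z \<in> ?S"
    then show "z \<le> max (\<bar>a 0 0 + a 1 0\<bar> + \<bar>a 0 1 + a 1 1\<bar>) (\<bar>a 0 0 - a 1 0\<bar> + \<bar>a 0 1 - a 1 1\<bar>)"
      by (auto simp only: mem_Collect_eq T norm_c0_le_iff intro!: bilinear_form_2x2_le)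
  qed
  then show ?thesis by (simp only: bilinear_norm_def)
qed

end
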